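(* Let $(X,\mathbb{F})$ be a non-autonomous system generated by a family $\mathbb{F}=(f_n)$ commuting with a map $f$, and suppose $(f_n)$ converges strongly to $f$. Let $x,y\in X$. If $(x,y)$ is regionally syndetically proximal for $(X,f)$, then $(x,y)$ is regionally syndetically proximal for $(X,\mathbb{F})$. Further, if $(X,\mathbb{F})$ is asymptotically commutative and $\mathbb{F}$ is a family of homeomorphisms, the converse also holds: if $(x,y)$ is regionally syndetically proximal for $(X,\mathbb{F})$, then $(x,y)$ is regionally syndetically proximal for $(X,f)$.
   Context: A non-autonomous system $(X,\mathbb{F})$ consists of a compact metric space $(X,d_X)$ and a sequence $\mathbb{F}=(f_n)_{n\ge 1}$ of surjective continuous self-maps of $X$; $\omega_n=f_n\circ\cdots\circ f_1$. $\mathbb{F}$ commutes with $f$ if $f_n\circ f=f\circ f_n$ for all $n$. $(X,f)$ denotes the autonomous system, for which $\omega_n=f^n$. $D_{C(X)}(g,h)=\sup_{x\in X}d_X(g(x),h(x))$ for continuous self-maps $g,h$ of $X$. $(f_n)$ converges strongly to the continuous map $f:X\to X$ if $\sum_{n=1}^\infty D_{C(X)}(f_n,f)<\infty$. A set $S=\{s_n:n\in\mathbb{N}\}\subseteq\mathbb{N}$ (with $s_1<s_2<\cdots$) is syndetic if there is $M\in\mathbb{N}$ with $|s_{n+1}-s_n|\le M$ for all $n$. A pair $(x,y)\in X\times X$ is regionally syndetically proximal for a system if for every $\epsilon>0$ and all neighborhoods $U$ of $x$ and $V$ of $y$ there are $z_1\in U$, $z_2\in V$ such that $\{n\in\mathbb{N}: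 d_X(\omega_n(z_1),\omega_n(z_2))<\epsilon\}$ is syndetic. $(X,\mathbb{F})$ is asymptotically commutative if $\lim_{n\to\infty}D_{C(X)}(\omega_n\circ\omega_r,\omega_r\circ\omega_n)=0$ for every $r\in\mathbb{N}$. *)

theory Defs
  imports "HOL-Analysis.Analysis"
begin

text \<open>
  The space is a compact subset \<open>X\<close> of a metric type; only the behaviour of maps on \<open>X\<close> matters.
  Families \<open>F = (f\<^sub>n)\<close> are indexed from 1 as in the literature: the value \<open>F 0\<close> is never used,
  and \<open>orbit_map F n\<close> is \<open>\<omega>\<^sub>n = f\<^sub>n \<circ> \<dots> \<circ> f\<^sub>1\<close>, with \<open>\<omega>\<^sub>0\<close> the identity.
\<close>

definition non_autonomous_system :: "'a::metric_space set \<Rightarrow> (nat \<Rightarrow> 'a \<Rightarrow> 'a) \<Rightarrow> bool" where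
  "non_autonomous_system X F \<longleftrightarrow>
     compact X \<and> (\<forall>n\<ge>1. continuous_on X (F n) \<and> F n ` X = X)"

primrec orbit_map :: "(nat \<Rightarrow> 'a \<Rightarrow> 'a) \<Rightarrow> nat \<Rightarrow> 'a \<Rightarrow> 'a" where
  "orbit_map F 0 = id"
| "orbit_map F (Suc n) = F (Suc n) \<circ> orbit_map F n"

text \<open>The autonomous system \<open>(X, f)\<close> is represented by the constant family.\<close>

lemma orbit_map_const: "orbit_map (\<lambda>_. f) n = f ^^ n"
  by (induction n) auto

definition commutes_with :: "'a set \<Rightarrow> (nat \<Rightarrow> 'a \<Rightarrow> 'a) \<Rightarrow> ('a \<Rightarrow> 'a) \<Rightarrow> bool" where
  "commutes_with X F f \<longleftrightarrow> (\<forall>n\<ge>1. \<forall>x\<in>X. F n (f x) = f (F n x))"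

text \<open>
  The supremum is taken in the reals; it is the genuine one when \<open>X\<close> is nonempty and compact and
  the maps are continuous on \<open>X\<close>.
\<close>

definition D_C :: "'a::metric_space set \<Rightarrow> ('a \<Rightarrow> 'a) \<Rightarrow> ('a \<Rightarrow> 'a) \<Rightarrow> real" where
  "D_C X g h = (SUP x\<in>X. dist (g x) (h x))"

text \<open>The shift by \<open>Suc\<close> makes the series start at index 1.\<close>

definition converges_strongly ::
    "'a::metric_space set \<Rightarrow> (nat \<Rightarrow> 'a \<Rightarrow> 'a) \<Rightarrow> ('a \<Rightarrow> 'a) \<Rightarrow> bool" where
  "converges_strongly X F f \<longleftrightarrow> summable (\<lambda>n. D_C X (F (Suc n)) f)"

text \<open>The enumeration \<open>s\<close> is indexed from 0 rather than from 1; a syndetic set is infinite.\<close>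

definition syndetic :: "nat set \<Rightarrow> bool" where
  "syndetic S \<longleftrightarrow>
     (\<exists>s. strict_mono s \<and> S = range s \<and> (\<exists>M. \<forall>n. s (Suc n) - s n \<le> M))"

definition regionally_syndetically_proximal ::
    "'a::metric_space set \<Rightarrow> (nat \<Rightarrow> 'a \<Rightarrow> 'a) \<Rightarrow> 'a \<Rightarrow> 'a \<Rightarrow> bool" where
  "regionally_syndetically_proximal X F x y \<longleftrightarrow>
     (\<forall>\<epsilon>>0. \<forall>U V. openin (top_of_set X) U \<and> x \<in> U \<and> openin (top_of_set X) V \<and> y \<in> V \<longrightarrow>
        (\<exists>z\<^sub>1\<in>U. \<exists>z\<^sub>2\<in>V.
           syndetic {n. n \<ge> 1 \<and> dist (orbit_map F n z\<^sub>1) (orbit_map F n z\<^sub>2) < \<epsilon>}))"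

definition asymptotically_commutative ::
    "'a::metric_space set \<Rightarrow> (nat \<Rightarrow> 'a \<Rightarrow> 'a) \<Rightarrow> bool" where
  "asymptotically_commutative X F \<longleftrightarrow>
     (\<forall>r\<ge>1. (\<lambda>n. D_C X (orbit_map F n \<circ> orbit_map F r) (orbit_map F r \<circ> orbit_map F n))
              \<longlonglongrightarrow> 0)"

definition family_of_homeomorphisms ::
    "'a::topological_space set \<Rightarrow> (nat \<Rightarrow> 'a \<Rightarrow> 'a) \<Rightarrow> bool" where
  "family_of_homeomorphisms X F \<longleftrightarrow> (\<forall>n\<ge>1. \<exists>g. homeomorphism X X (F n) g)"

end

theory Submission
  imports Defs
begin

text \<open>
  Since \<open>f\<close> commutes with every \<open>f\<^sub>n\<close>, the outermost map of
  \<open>f\<^bsub>r+m\<^esub> \<circ> \<dots> \<circ> f\<^bsub>r+1\<^esub>\<close> can be replaced by \<open>f\<close>, which is then moved to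
  the right end; repeating this shows that \<open>\<omega>\<^bsub>r+m\<^esub>\<close> differs from \<open>f\<^sup>m \<circ> \<omega>\<^sub>r\<close> by at most the tail
  \<open>\<Sum>k>r. D_C f\<^sub>k f\<close>, uniformly in \<open>m\<close>. For the first implication,
  \<open>f\<^sup>m \<circ> \<omega>\<^sub>r = \<omega>\<^sub>r \<circ> f\<^sup>m\<close> and \<open>\<omega>\<^sub>r\<close> is uniformly continuous. For the second one, write
  \<open>z = \<omega>\<^sub>r w\<close>; then \<open>\<omega>\<^sub>n z\<close> is close to \<open>\<omega>\<^sub>r (\<omega>\<^sub>n w)\<close> for large \<open>n\<close>, so uniform continuity of the
  inverse of \<open>\<omega>\<^sub>r\<close> controls \<open>\<omega>\<^sub>n w\<close>, which is close to \<open>f\<^bsup>n-r\<^esup> z\<close>. In both cases the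
  points witnessing proximality for one system also witness it for the other.
\<close>

section \<open>Syndetic sets: enumeration with bounded gaps versus windows of bounded length\<close>

lemma syndetic_iff:
  "syndetic S \<longleftrightarrow> (\<exists>M. \<forall>k. \<exists>n\<in>S. k \<le> n \<and> n \<le> k + M)"
proof
  assume "syndetic S"
  then obtain s M where s: "strict_mono s" "S = range s" "\<And>n. s (Suc n) - s n \<le> M"
    unfolding syndetic_def by blast
  \<comment> \<open>A gap bound says nothing about where the set starts, so \<open>s 0\<close>
    enters the window length.\<close>
  have "\<exists>n\<in>S. k \<le> n \<and> n \<le> k + (M + s 0)" for k
  proof -
    \<comment> \<open>By minimality the element before \<open>s j\<close> lies below
      \<open>k\<close>, so a single gap bounds \<open>s j\<close>.\<close>
    define j where "j = (LEAST j. k \<le> s j)"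
    have "k \<le> s k" using s(1) by (rule strict_mono_imp_increasing)
    then have j: "k \<le> s j" unfolding j_def by (rule LeastI)
    have "s j \<le> k + (M + s 0)"
    proof (cases j)
      case (Suc i)
      then have "\<not> k \<le> s i" unfolding j_def by (metis lessI not_less_Least)
      then show ?thesis using s(3)[of i] Suc by simp
    qed simp
    with j s(2) show ?thesis by blast
  qed
  then show "\<exists>M. \<forall>k. \<exists>n\<in>S. k \<le> n \<and> n \<le> k + M" by blast
next
  assume "\<exists>M. \<forall>k. \<exists>n\<in>S. k \<le> n \<and> n \<le> k + M"
  then obtain M where M: "\<And>k. \<exists>n\<in>S. k \<le> n \<and> n \<le> k + M" by blast
  then have inf: "infinite S"
    unfolding infinite_nat_iff_unbounded_le by blast
  have "enumerate S (Suc n) - enumerate S n \<le> Suc M" for n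
  proof -
    \<comment> \<open>A window starting just after the current element contains a later one, and the
      next element comes no later than that.\<close>
    obtain m where "m \<in> S" "Suc (enumerate S n) \<le> m" "m \<le> Suc (enumerate S n) + M"
      using M by blast
    moreover from this have "enumerate S (Suc n) \<le> m"
      using enumerate_Suc''[OF inf, of n] by (auto intro: Least_le)
    ultimately show ?thesis by simp
  qed
  moreover have "strict_mono (enumerate S)" "S = range (enumerate S)"
    using inf by (simp_all add: strict_mono_enumerate range_enumerate)
  ultimately show "syndetic S" unfolding syndetic_def by blast
qed

text \<open>Shifting times by at most \<open>a\<close> and dropping an initial segment only lengthen
  the windows. This absorbs the delay \<open>r\<close> between the two systems.\<close>

lemma syndetic_near:
  assumes "syndetic S"
    and near: "\<And>n. n \<in> S \<Longrightarrow> N \<le> n \<Longrightarrow> \<exists>m\<in>T. m \<le> n + a \<and> n \<le> m + a"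
  shows "syndetic T"
proof -
  obtain M where M: "\<And>k. \<exists>n\<in>S. k \<le> n \<and> n \<le> k + M"
    using assms(1) unfolding syndetic_iff by blast
  have "\<exists>m\<in>T. k \<le> m \<and> m \<le> k + (N + a + M + a)" for k
  proof -
    \<comment> \<open>Starting at \<open>k + N + a\<close> ensures both \<open>N \<le> n\<close> and
      that stepping back by \<open>a\<close> stays at or above \<open>k\<close>.\<close>
    obtain n where n: "n \<in> S" "k + N + a \<le> n" "n \<le> k + N + a + M"
      using M by blast
    then obtain m where "m \<in> T" "m \<le> n + a" "n \<le> m + a"
      using near[of n] by auto
    with n show ?thesis by (intro bexI[of _ m]) auto
  qed
  then show ?thesis unfolding syndetic_iff by blast
qed

text \<open>The witnesses are only known once \<delta> is fixed, so \<delta> has to be uniform over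
  all pairs in \<open>X\<close>. The same witnesses then serve for \<open>G\<close>.\<close>

lemma regionally_syndetically_proximal_transfer:
  assumes "regionally_syndetically_proximal X F x y"
    and "\<And>\<epsilon>. \<epsilon> > 0 \<Longrightarrow> \<exists>\<delta>>0. \<forall>z\<in>X. \<forall>w\<in>X.
      syndetic {n. n \<ge> 1 \<and> dist (orbit_map F n z) (orbit_map F n w) < \<delta>} \<longrightarrow>
      syndetic {n. n \<ge> 1 \<and> dist (orbit_map G n z) (orbit_map G n w) < \<epsilon>}"
  shows "regionally_syndetically_proximal X G x y"
  unfolding regionally_syndetically_proximal_def
proof (intro allI impI)
  fix \<epsilon> :: real and U V
  assume "\<epsilon> > 0"
    and UV: "openin (top_of_set X) U \<and> x \<in> U \<and> openin (top_of_set X) V \<and> y \<in> V"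
  then obtain \<delta> where "\<delta> > 0" and \<delta>: "\<And>z w. z \<in> X \<Longrightarrow> w \<in> X \<Longrightarrow>
      syndetic {n. n \<ge> 1 \<and> dist (orbit_map F n z) (orbit_map F n w) < \<delta>} \<Longrightarrow>
      syndetic {n. n \<ge> 1 \<and> dist (orbit_map G n z) (orbit_map G n w) < \<epsilon>}"
    using assms(2) by blast
  obtain z w where "z \<in> U" "w \<in> V"
    "syndetic {n. n \<ge> 1 \<and> dist (orbit_map F n z) (orbit_map F n w) < \<delta>}"
    using assms(1) UV \<open>\<delta> > 0\<close> unfolding regionally_syndetically_proximal_def by blast
  moreover have "U \<subseteq> X" "V \<subseteq> X" using UV openin_imp_subset by blast+
  ultimately show "\<exists>z\<in>U. \<exists>w\<in>V.
      syndetic {n. n \<ge> 1 \<and> dist (orbit_map G n z) (orbit_map G n w) < \<epsilon>}"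
    using \<delta> by blast
qed

section \<open>Orbit maps and the supremum distance\<close>

lemma dist_le_D_C:
  assumes "bounded X" "g \<in> X \<rightarrow> X" "h \<in> X \<rightarrow> X" "z \<in> X"
  shows "dist (g z) (h z) \<le> D_C X g h"
  unfolding D_C_def
proof (rule cSUP_upper[OF \<open>z \<in> X\<close>])
  show "bdd_above ((\<lambda>z. dist (g z) (h z)) ` X)"
    using assms diameter_bounded_bound[OF \<open>bounded X\<close>]
    by (intro bdd_aboveI2[where M = "diameter X"]) blast
qed

lemma orbit_map_in:
  assumes "\<And>n. n \<ge> 1 \<Longrightarrow> F n \<in> X \<rightarrow> X" "z \<in> X"
  shows "orbit_map F n z \<in> X"
  using assms by (induction n) (auto simp: Pi_iff)

lemma orbit_map_add:
  "orbit_map F (r + m) z = orbit_map (\<lambda>k. F (r + k)) m (orbit_map F r z)"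
  by (induction m) auto

lemma orbit_map_funpow_commute:
  assumes "commutes_with X F f" "f \<in> X \<rightarrow> X" "\<And>n. n \<ge> 1 \<Longrightarrow> F n \<in> X \<rightarrow> X" "z \<in> X"
  shows "orbit_map F n ((f ^^ m) z) = (f ^^ m) (orbit_map F n z)"
proof -
  have one: "orbit_map F n (f w) = f (orbit_map F n w)" if "w \<in> X" for w
    using that assms(1) orbit_map_in[OF assms(3)]
    by (induction n) (auto simp: commutes_with_def)
  have "(f ^^ m) z \<in> X" for m
    using assms(2,4) by (induction m) auto
  then show ?thesis by (induction m) (auto simp: one)
qed

lemma continuous_on_orbit_map:
  assumes "\<And>n. n \<ge> 1 \<Longrightarrow> continuous_on X (F n)" "\<And>n. n \<ge> 1 \<Longrightarrow> F n \<in> X \<rightarrow> X"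
  shows "continuous_on X (orbit_map F n)"
proof (induction n)
  case (Suc n)
  have "continuous_on (orbit_map F n ` X) (F (Suc n))"
    using assms(1)[of "Suc n"] orbit_map_in[OF assms(2)]
    by (auto intro: continuous_on_subset)
  with Suc show ?case unfolding orbit_map.simps by (rule continuous_on_compose)
qed (simp add: continuous_on_id id_def)

lemma homeomorphism_orbit_map:
  assumes "family_of_homeomorphisms X F"
  shows "\<exists>g. homeomorphism X X (orbit_map F n) g"
proof (induction n)
  case 0
  then show ?case using homeomorphism_ident by (auto simp: id_def)
next
  case (Suc n)
  then show ?case
    using assms homeomorphism_compose unfolding family_of_homeomorphisms_def
    by (metis orbit_map.simps(2) One_nat_def Suc_le_mono zero_le)
qed

section \<open>Uniform comparison of orbit maps with iterates of the limit\<close>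

lemma dist_orbit_map_funpow_le:
  assumes "bounded X" "f \<in> X \<rightarrow> X" "\<And>n. n \<ge> 1 \<Longrightarrow> F n \<in> X \<rightarrow> X"
    and "commutes_with X F f" "z \<in> X"
  shows "dist (orbit_map F m z) ((f ^^ m) z) \<le> (\<Sum>k<m. D_C X (F (Suc k)) f)"
  using \<open>z \<in> X\<close>
\<comment> \<open>The induction hypothesis is used at \<open>f z\<close>. Since \<open>f\<close> is
  moved innermost first, it is never applied to two merely close points, and errors add up without
  any modulus of continuity.\<close>
proof (induction m arbitrary: z)
  case (Suc m)
  let ?u = "orbit_map F m z"
  have "dist (F (Suc m) ?u) (f ?u) \<le> D_C X (F (Suc m)) f"
    using assms Suc.prems by (intro dist_le_D_C orbit_map_in) auto
  moreover have "f ?u = orbit_map F m (f z)"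
    using orbit_map_funpow_commute[of X F f z m 1] assms Suc.prems by simp
  moreover have "dist (orbit_map F m (f z)) ((f ^^ m) (f z)) \<le> (\<Sum>k<m. D_C X (F (Suc k)) f)"
    using Suc assms(2) by blast
  moreover have "(f ^^ Suc m) z = (f ^^ m) (f z)" by (simp add: funpow_swap1)
  ultimately show ?case
    using dist_triangle[of "F (Suc m) ?u" "(f ^^ Suc m) z" "f ?u"] by simp
qed simp

text \<open>After splitting off the first \<open>r\<close> maps, the shifted family still commutes
  with \<open>f\<close>, and its error sum is part of a tail of a convergent series. So one
  \<open>r\<close> works for all \<open>m\<close> and \<open>z\<close>.\<close>

lemma dist_orbit_map_add_small:
  assumes "bounded X" "f \<in> X \<rightarrow> X" "\<And>n. n \<ge> 1 \<Longrightarrow> F n \<in> X \<rightarrow> X"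
    and "commutes_with X F f" "converges_strongly X F f" "\<epsilon> > 0"
  obtains r where "r \<ge> 1"
    "\<And>m z. z \<in> X \<Longrightarrow> dist (orbit_map F (r + m) z) ((f ^^ m) (orbit_map F r z)) < \<epsilon>"
proof -
  let ?D = "\<lambda>n. D_C X (F (Suc n)) f"
  have summable: "summable ?D" using assms(5) by (simp add: converges_strongly_def)
  obtain N where N: "\<And>n. n \<ge> N \<Longrightarrow> norm (\<Sum>i. ?D (i + n)) < \<epsilon>"
    using suminf_exist_split[OF \<open>\<epsilon> > 0\<close> summable] by blast
  \<comment> \<open>The successor secures \<open>r \<ge> 1\<close>, which asymptotic commutativity
    at index \<open>r\<close> requires.\<close>
  define r where "r = Suc N"
  have "dist (orbit_map F (r + m) z) ((f ^^ m) (orbit_map F r z)) < \<epsilon>" if z: "z \<in> X" for m z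
  proof -
    let ?G = "\<lambda>k. F (r + k)"
    have "commutes_with X ?G f"
      using assms(4) by (simp add: commutes_with_def)
    moreover have "orbit_map F r z \<in> X" using assms(3) z by (rule orbit_map_in)
    ultimately have "dist (orbit_map F (r + m) z) ((f ^^ m) (orbit_map F r z))
        \<le> (\<Sum>k<m. D_C X (?G (Suc k)) f)"
      unfolding orbit_map_add using assms by (intro dist_orbit_map_funpow_le) auto
    also have "\<dots> = (\<Sum>k<m. ?D (k + r))" by (simp add: add.commute)
    also have "\<dots> \<le> (\<Sum>k. ?D (k + r))"
    proof (rule sum_le_suminf)
      show "summable (\<lambda>k. ?D (k + r))" using summable by (rule summable_ignore_initial_segment)
      fix k
      \<comment> \<open>The point \<open>z\<close> shows that \<open>X\<close> is nonempty, so the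
        supremum dominates an actual distance and is nonnegative.\<close>
      have "0 \<le> dist (F (Suc (k + r)) z) (f z)" by simp
      also have "\<dots> \<le> ?D (k + r)" using assms z by (intro dist_le_D_C) auto
      finally show "0 \<le> ?D (k + r)" .
    qed simp
    also have "\<dots> < \<epsilon>" using N[of r] by (simp add: r_def)
    finally show ?thesis .
  qed
  then show thesis using that[of r] by (simp add: r_def)
qed

section \<open>The two implications\<close>

lemma regionally_syndetically_proximal_from_limit:
  assumes "compact X" "f \<in> X \<rightarrow> X"
    and maps: "\<And>n. n \<ge> 1 \<Longrightarrow> F n \<in> X \<rightarrow> X"
    and cont: "\<And>n. n \<ge> 1 \<Longrightarrow> continuous_on X (F n)"
    and comm: "commutes_with X F f" and "converges_strongly X F f"
    and "regionally_syndetically_proximal X (\<lambda>_. f) x y"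
  shows "regionally_syndetically_proximal X F x y"
proof (rule regionally_syndetically_proximal_transfer[OF assms(7)])
  fix \<epsilon> :: real
  assume \<epsilon>: "\<epsilon> > 0"
  have bounded: "bounded X" using \<open>compact X\<close> by (rule compact_imp_bounded)
  obtain r where r: "r \<ge> 1"
    "\<And>m z. z \<in> X \<Longrightarrow> dist (orbit_map F (r + m) z) ((f ^^ m) (orbit_map F r z)) < \<epsilon> / 3"
    using dist_orbit_map_add_small[OF bounded assms(2) maps comm assms(6), of "\<epsilon> / 3"] \<epsilon> by auto
  have "uniformly_continuous_on X (orbit_map F r)"
    using continuous_on_orbit_map[OF cont maps] \<open>compact X\<close>
    by (rule compact_uniformly_continuous)
  then obtain \<delta> where \<delta>: "\<delta> > 0" and uc: "\<And>z w. z \<in> X \<Longrightarrow> w \<in> X \<Longrightarrow> dist z w < \<delta> \<Longrightarrow>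
      dist (orbit_map F r z) (orbit_map F r w) < \<epsilon> / 3"
    unfolding uniformly_continuous_on_def using \<epsilon> by (metis divide_pos_pos zero_less_numeral)
  have iter: "(f ^^ n) z \<in> X" if "z \<in> X" for n z
    using that assms(2) by (induction n) auto
  have near: "dist (orbit_map F (r + n) z) (orbit_map F (r + n) w) < \<epsilon>"
    if "z \<in> X" "w \<in> X" "dist ((f ^^ n) z) ((f ^^ n) w) < \<delta>" for n z w
  proof -
    \<comment> \<open>Commuting turns these points into the images under
      \<open>orbit_map F r\<close> of \<delta>-close points. The other two thirds of \<epsilon> pay
      for replacing each orbit by iterates of \<open>f\<close>.\<close>
    have "dist ((f ^^ n) (orbit_map F r z)) ((f ^^ n) (orbit_map F r w)) < \<epsilon> / 3"
      using uc[of "(f ^^ n) z" "(f ^^ n) w"] that iter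
        orbit_map_funpow_commute[OF comm assms(2) maps] by simp
    then show ?thesis
      using r(2)[OF that(1), of n] r(2)[OF that(2), of n] by metric
  qed
  show "\<exists>\<delta>>0. \<forall>z\<in>X. \<forall>w\<in>X.
      syndetic {n. n \<ge> 1 \<and> dist (orbit_map (\<lambda>_. f) n z) (orbit_map (\<lambda>_. f) n w) < \<delta>} \<longrightarrow>
      syndetic {n. n \<ge> 1 \<and> dist (orbit_map F n z) (orbit_map F n w) < \<epsilon>}"
  proof (intro exI[of _ \<delta>] conjI ballI impI \<delta>)
    fix z w
    assume zw: "z \<in> X" "w \<in> X" and
      "syndetic {n. n \<ge> 1 \<and> dist (orbit_map (\<lambda>_. f) n z) (orbit_map (\<lambda>_. f) n w) < \<delta>}"
    from this(3) show "syndetic {n. n \<ge> 1 \<and> dist (orbit_map F n z) (orbit_map F n w) < \<epsilon>}"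
    \<comment> \<open>Time \<open>n\<close> for \<open>f\<close> corresponds to time
      \<open>r + n\<close> for \<open>F\<close>.\<close>
    proof (rule syndetic_near[where N = 0 and a = r])
      fix n
      assume "n \<in> {n. n \<ge> 1 \<and> dist (orbit_map (\<lambda>_. f) n z) (orbit_map (\<lambda>_. f) n w) < \<delta>}"
      then show "\<exists>m\<in>{n. n \<ge> 1 \<and> dist (orbit_map F n z) (orbit_map F n w) < \<epsilon>}.
          m \<le> n + r \<and> n \<le> m + r"
        using near[OF zw] by (intro bexI[of _ "r + n"]) (auto simp: orbit_map_const)
    qed
  qed
qed

lemma regionally_syndetically_proximal_limit:
  assumes "compact X" "f \<in> X \<rightarrow> X"
    and maps: "\<And>n. n \<ge> 1 \<Longrightarrow> F n \<in> X \<rightarrow> X"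
    and comm: "commutes_with X F f" and "converges_strongly X F f"
    and "asymptotically_commutative X F" "family_of_homeomorphisms X F"
    and "regionally_syndetically_proximal X F x y"
  shows "regionally_syndetically_proximal X (\<lambda>_. f) x y"
proof (rule regionally_syndetically_proximal_transfer[OF assms(8)])
  fix \<epsilon> :: real
  assume \<epsilon>: "\<epsilon> > 0"
  have bounded: "bounded X" using \<open>compact X\<close> by (rule compact_imp_bounded)
  obtain r where r: "r \<ge> 1"
    "\<And>m z. z \<in> X \<Longrightarrow> dist (orbit_map F (r + m) z) ((f ^^ m) (orbit_map F r z)) < \<epsilon> / 3"
    using dist_orbit_map_add_small[OF bounded assms(2) maps comm assms(5), of "\<epsilon> / 3"] \<epsilon> by auto
  obtain g where g: "homeomorphism X X (orbit_map F r) g"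
    using homeomorphism_orbit_map[OF assms(7)] by blast
  have g_in: "g z \<in> X" and orbit_g: "orbit_map F r (g z) = z" if "z \<in> X" for z
    using g that by (auto simp: homeomorphism_def)
  have "uniformly_continuous_on X g"
    using g \<open>compact X\<close> by (auto simp: homeomorphism_def intro: compact_uniformly_continuous)
  then obtain \<delta> where \<delta>: "\<delta> > 0" and uc: "\<And>z w. z \<in> X \<Longrightarrow> w \<in> X \<Longrightarrow> dist z w < \<delta> \<Longrightarrow>
      dist (g z) (g w) < \<epsilon> / 3"
    unfolding uniformly_continuous_on_def using \<epsilon> by (metis divide_pos_pos zero_less_numeral)
  have orbit_in: "orbit_map F n z \<in> X" if "z \<in> X" for n z
    using maps that by (rule orbit_map_in)
  let ?C = "\<lambda>n. D_C X (orbit_map F n \<circ> orbit_map F r) (orbit_map F r \<circ> orbit_map F n)"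
  have "?C \<longlonglongrightarrow> 0"
    using assms(6) r(1) by (simp add: asymptotically_commutative_def)
  moreover have "\<delta> / 3 > 0" using \<delta> by simp
  ultimately have "\<forall>\<^sub>F n in sequentially. ?C n < \<delta> / 3" by (rule order_tendstoD)
  then obtain N where N: "\<And>n. n \<ge> N \<Longrightarrow> ?C n < \<delta> / 3"
    by (auto simp: eventually_sequentially)
  \<comment> \<open>Since \<open>z\<close> is \<open>orbit_map F r (g z)\<close>, this is the
    commutator of the two orbit maps evaluated at \<open>g z\<close>.\<close>
  have close: "dist (orbit_map F n z) (orbit_map F r (orbit_map F n (g z))) < \<delta> / 3"
    if "n \<ge> N" "z \<in> X" for n z
  proof -
    have "dist (orbit_map F n z) (orbit_map F r (orbit_map F n (g z))) \<le> ?C n"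
      using dist_le_D_C[OF bounded, of "orbit_map F n \<circ> orbit_map F r"
          "orbit_map F r \<circ> orbit_map F n" "g z"] that
      by (simp add: orbit_in g_in orbit_g)
    with N[OF that(1)] show ?thesis by simp
  qed
  have near: "dist ((f ^^ m) z) ((f ^^ m) w) < \<epsilon>"
    if "z \<in> X" "w \<in> X" "r + m \<ge> N"
      and "dist (orbit_map F (r + m) z) (orbit_map F (r + m) w) < \<delta> / 3" for m z w
  proof -
    let ?z = "orbit_map F (r + m) (g z)" and ?w = "orbit_map F (r + m) (g w)"
    \<comment> \<open>One third of \<delta> comes from the assumed proximity, and one from the
      commutation error at each of the two points.\<close>
    have "dist (orbit_map F r ?z) (orbit_map F r ?w) < \<delta>"
      using close[OF that(3,1)] close[OF that(3,2)] that(4) by metric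
    then have "dist (g (orbit_map F r ?z)) (g (orbit_map F r ?w)) < \<epsilon> / 3"
      by (intro uc orbit_in g_in that)
    moreover have "g (orbit_map F r v) = v" if "v \<in> X" for v
      using g that by (auto simp: homeomorphism_def)
    ultimately have "dist ?z ?w < \<epsilon> / 3"
      using that by (simp add: orbit_in g_in)
    \<comment> \<open>The comparison is taken at \<open>g z\<close> and \<open>g w\<close>, where
      \<open>orbit_map F r\<close> gives back \<open>z\<close> and \<open>w\<close>.\<close>
    moreover have "dist ?z ((f ^^ m) z) < \<epsilon> / 3" "dist ?w ((f ^^ m) w) < \<epsilon> / 3"
      using r(2)[of "g z" m] r(2)[of "g w" m] that by (simp_all add: g_in orbit_g)
    ultimately show ?thesis by metric
  qed
  show "\<exists>\<delta>>0. \<forall>z\<in>X. \<forall>w\<in>X.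
      syndetic {n. n \<ge> 1 \<and> dist (orbit_map F n z) (orbit_map F n w) < \<delta>} \<longrightarrow>
      syndetic {n. n \<ge> 1 \<and> dist (orbit_map (\<lambda>_. f) n z) (orbit_map (\<lambda>_. f) n w) < \<epsilon>}"
  proof (intro exI[of _ "\<delta> / 3"] conjI ballI impI)
    show "\<delta> / 3 > 0" using \<delta> by simp
    fix z w
    assume zw: "z \<in> X" "w \<in> X" and
      "syndetic {n. n \<ge> 1 \<and> dist (orbit_map F n z) (orbit_map F n w) < \<delta> / 3}"
    from this(3)
    show "syndetic {n. n \<ge> 1 \<and> dist (orbit_map (\<lambda>_. f) n z) (orbit_map (\<lambda>_. f) n w) < \<epsilon>}"
    \<comment> \<open>Beyond this bound \<open>n - r\<close> is a genuine difference, at least 1,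
      and \<open>n\<close> is late enough for the commutation estimate.\<close>
    proof (rule syndetic_near[where N = "N + Suc r" and a = r])
      fix n
      assume "n \<in> {n. n \<ge> 1 \<and> dist (orbit_map F n z) (orbit_map F n w) < \<delta> / 3}"
        and "N + Suc r \<le> n"
      then show "\<exists>m\<in>{n. n \<ge> 1 \<and>
          dist (orbit_map (\<lambda>_. f) n z) (orbit_map (\<lambda>_. f) n w) < \<epsilon>}. m \<le> n + r \<and> n \<le> m + r"
        using near[OF zw, of "n - r"]
        by (intro bexI[of _ "n - r"]) (auto simp: orbit_map_const)
    qed
  qed
qed

theorem corollary5p2:
  fixes X :: "'a::metric_space set"
    and F :: "nat \<Rightarrow> 'a \<Rightarrow> 'a"
    and f :: "'a \<Rightarrow> 'a"
    and x y :: 'a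
  assumes "non_autonomous_system X F"
    and "continuous_on X f" and "f \<in> X \<rightarrow> X"
    and "commutes_with X F f"
    and "converges_strongly X F f"
    and "x \<in> X" and "y \<in> X"
  shows "(regionally_syndetically_proximal X (\<lambda>_. f) x y \<longrightarrow>
            regionally_syndetically_proximal X F x y) \<and>
         (asymptotically_commutative X F \<and> family_of_homeomorphisms X F \<longrightarrow>
            regionally_syndetically_proximal X F x y \<longrightarrow>
            regionally_syndetically_proximal X (\<lambda>_. f) x y)"
proof -
  have "compact X" "\<And>n. n \<ge> 1 \<Longrightarrow> F n \<in> X \<rightarrow> X" "\<And>n. n \<ge> 1 \<Longrightarrow> continuous_on X (F n)"
    using assms(1) unfolding non_autonomous_system_def by blast+
  then show ?thesis
    using regionally_syndetically_proximal_from_limit[of X f F x y]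
      regionally_syndetically_proximal_limit[of X f F x y] assms(3-5) by blast
qed

end
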